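(* Let $k\geq 2$. For every $N\in\{0,1,2,\dots\}$, the oriented de Bruijn graph $\vec B_{k,N}$ is weakly isomorphic (i.e. isomorphic as oriented graphs, ignoring labels) to $\vec\Gamma_{k,N}$, the graph of the action of $\mathcal L_k$ on the $N$-th level of the $k$-regular rooted tree with respect to the generating set $X_k=\{\bar c_0,\dots,\bar c_{k-1}\}$.
   Context: An oriented graph has vertices, edges and maps $\iota,\tau$; loops and multiple edges allowed. The oriented de Bruijn graph $\vec B_{k,N}$ has vertex set $\{0,\dots,k-1\}^N$ and, for each vertex $x_1\dots x_N$ and each $y\in\{0,\dots,k-1\}$, one edge labeled $R_y$ from $x_1\dots x_N$ to $x_2\dots x_Ny$. $\mathcal L_k=(\mathbb Z/k\mathbb Z)\wr\mathbb Z$, $b$ the generator of $\mathbb Z$, $c$ the generator of the copy of $\mathbb Z/k\mathbb Z$ at coordinate 0, and $\bar c_r=c^rb$. $\mathcal L_k$ acts on words over $\{0,\dots,k-1\}$ (vertices of the $k$-regular rooted tree) by $\bar c_r.(x_1x_2x_3\dots)=\bigl((x_1+r)(x_2+x_1)(x_3+x_2)\dots\bigr)$, additions mod $k$. $\vec\Gamma_{k,N}$ is the oriented graph with vertex set the words of length $N$ and, for each vertex $v$ and each $r$, an edge labeled $\bar c_r$ from $v$ to $\bar c_r.v$. *)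

theory Defs
  imports
    "HOL-Algebra.Algebra"
    "HOL-Computational_Algebra.Formal_Power_Series"
    "HOL-Number_Theory.Cong"
    "Graph_Theory.Digraph_Isomorphism"
begin

section \<open>De Bruijn graphs\<close>

text \<open>
  Oriented graphs (loops and multiple edges allowed) are values of \<^typ>\<open>('v, 'e) pre_digraph\<close>.
  Labels are part of the names of the edges, so \<^const>\<open>digraph_iso\<close> ignores them.
\<close>

definition words :: "nat \<Rightarrow> int list set" where
  "words k = lists {0..<int k}"

definition level :: "nat \<Rightarrow> nat \<Rightarrow> int list set" where
  "level k N = {w \<in> words k. length w = N}"

text \<open>
  The edge \<open>(w, y)\<close> is the one labelled \<open>R\<^sub>y\<close> starting at \<open>w\<close>. Its end is
  \<open>w y\<close> without the first letter; for \<open>N = 0\<close> this is the empty word again, whereas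
  \<open>tl w @ [y]\<close> would have the wrong length.
\<close>

definition de_bruijn :: "nat \<Rightarrow> nat \<Rightarrow> (int list, int list \<times> int) pre_digraph" where
  "de_bruijn k N =
     \<lparr>verts = level k N, arcs = level k N \<times> {0..<int k},
      tail = fst, head = (\<lambda>(w, y). tl (w @ [y]))\<rparr>"


section \<open>The lamplighter group\<close>

text \<open>The restricted wreath product of \<open>A\<close> with the integers.\<close>

definition wreath_int :: "('a, 'm) monoid_scheme \<Rightarrow> ((int \<Rightarrow> 'a) \<times> int) monoid" where
  "wreath_int A =
     \<lparr>carrier = carrier (sum_group UNIV (\<lambda>_. A)) \<times> UNIV,
      monoid.mult = (\<lambda>(f, m) (g, n). (f \<otimes>\<^bsub>sum_group UNIV (\<lambda>_. A)\<^esub> (\<lambda>i. g (i - m)), m + n)),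
      one = (\<one>\<^bsub>sum_group UNIV (\<lambda>_. A)\<^esub>, 0)\<rparr>"

definition lamplighter :: "nat \<Rightarrow> ((int \<Rightarrow> int) \<times> int) monoid" where
  "lamplighter k = wreath_int (integer_mod_group k)"

definition gen_b :: "(int \<Rightarrow> int) \<times> int" where
  "gen_b = (\<lambda>_. 0, 1)"

definition gen_c :: "(int \<Rightarrow> int) \<times> int" where
  "gen_c = (\<lambda>i. if i = 0 then 1 else 0, 0)"

definition cbar :: "nat \<Rightarrow> nat \<Rightarrow> (int \<Rightarrow> int) \<times> int" where
  "cbar k r = gen_c [^]\<^bsub>lamplighter k\<^esub> r \<otimes>\<^bsub>lamplighter k\<^esub> gen_b"

definition lamplighter_gens :: "nat \<Rightarrow> ((int \<Rightarrow> int) \<times> int) set" where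
  "lamplighter_gens k = cbar k ` {..<k}"


section \<open>The action on the rooted tree and its graphs\<close>

text \<open>The word \<open>(x\<^sub>1 + r) (x\<^sub>2 + x\<^sub>1) (x\<^sub>3 + x\<^sub>2) \<dots>\<close>; \<^const>\<open>map2\<close> drops the surplus last letter.\<close>

definition cbar_word :: "nat \<Rightarrow> nat \<Rightarrow> int list \<Rightarrow> int list" where
  "cbar_word k r w = map2 (\<lambda>x y. (x + y) mod int k) w (int r # w)"

definition is_lamplighter_action ::
    "nat \<Rightarrow> ((int \<Rightarrow> int) \<times> int \<Rightarrow> int list \<Rightarrow> int list) \<Rightarrow> bool" where
  "is_lamplighter_action k \<phi> \<longleftrightarrow>
     group_action (lamplighter k) (words k) \<phi> \<and>
     \<phi> \<in> extensional (carrier (lamplighter k)) \<and>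
     (\<forall>r<k. \<forall>w\<in>words k. \<phi> (cbar k r) w = cbar_word k r w)"

text \<open>Existence and uniqueness (for \<open>k \<ge> 2\<close>) are proved below as \<open>ex1_lamplighter_action\<close>.\<close>

definition lamplighter_action :: "nat \<Rightarrow> (int \<Rightarrow> int) \<times> int \<Rightarrow> int list \<Rightarrow> int list" where
  "lamplighter_action k = (THE \<phi>. is_lamplighter_action k \<phi>)"

definition action_graph :: "('g \<Rightarrow> 'x \<Rightarrow> 'x) \<Rightarrow> 'x set \<Rightarrow> 'g set \<Rightarrow> ('x, 'x \<times> 'g) pre_digraph" where
  "action_graph \<phi> E S = \<lparr>verts = E, arcs = E \<times> S, tail = fst, head = (\<lambda>(v, s). \<phi> s v)\<rparr>"

definition lamplighter_graph ::
    "nat \<Rightarrow> nat \<Rightarrow> (int list, int list \<times> ((int \<Rightarrow> int) \<times> int)) pre_digraph" where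
  "lamplighter_graph k N = action_graph (lamplighter_action k) (level k N) (lamplighter_gens k)"


section \<open>The lamplighter group is a group generated by the \<open>cbar k r\<close>\<close>

lemma carrier_lamplighter:
  assumes "k \<ge> 2"
  shows "carrier (lamplighter k) = {f. (\<forall>i. f i \<in> {0..<int k}) \<and> finite {i. f i \<noteq> 0}} \<times> UNIV"
  using assms
  by (auto simp: lamplighter_def wreath_int_def carrier_sum_group carrier_integer_mod_group PiE_iff)

lemma mult_lamplighter:
  "(f, m) \<otimes>\<^bsub>lamplighter k\<^esub> (g, n) = (\<lambda>i. (f i + g (i - m)) mod int k, m + n)"
  by (simp add: lamplighter_def wreath_int_def restrict_def)

lemma one_lamplighter: "\<one>\<^bsub>lamplighter k\<^esub> = (\<lambda>_. 0, 0)"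
  by (simp add: lamplighter_def wreath_int_def restrict_def)

lemma finite_support_shift:
  fixes g :: "int \<Rightarrow> int"
  assumes "finite {i. g i \<noteq> 0}"
  shows "finite {i. g (i - m) \<noteq> 0}"
proof -
  have "{i. g (i - m) \<noteq> 0} = (\<lambda>i. i + m) ` {i. g i \<noteq> 0}"
    by (auto simp: image_iff intro!: exI[of _ "_ - m"])
  then show ?thesis using assms by simp
qed

lemma group_lamplighter:
  assumes k: "k \<ge> 2"
  shows "group (lamplighter k)"
proof (rule groupI)
  fix x y assume "x \<in> carrier (lamplighter k)" "y \<in> carrier (lamplighter k)"
  then obtain f m g n where xy: "x = (f, m)" "y = (g, n)"
    and fin: "finite {i. f i \<noteq> 0}" "finite {i. g i \<noteq> 0}"
    by (auto simp: carrier_lamplighter[OF k])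
  have "finite {i. (f i + g (i - m)) mod int k \<noteq> 0}"
    by (rule finite_subset[OF _ finite_UnI[OF fin(1) finite_support_shift[OF fin(2), of m]]]) auto
  then show "x \<otimes>\<^bsub>lamplighter k\<^esub> y \<in> carrier (lamplighter k)"
    using k by (auto simp: xy mult_lamplighter carrier_lamplighter)
next
  show "\<one>\<^bsub>lamplighter k\<^esub> \<in> carrier (lamplighter k)"
    using k by (auto simp: one_lamplighter carrier_lamplighter)
next
  fix x y z assume "x \<in> carrier (lamplighter k)"
    "y \<in> carrier (lamplighter k)" "z \<in> carrier (lamplighter k)"
  show "x \<otimes>\<^bsub>lamplighter k\<^esub> y \<otimes>\<^bsub>lamplighter k\<^esub> z = x \<otimes>\<^bsub>lamplighter k\<^esub> (y \<otimes>\<^bsub>lamplighter k\<^esub> z)"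
    by (cases x; cases y; cases z)
      (simp add: mult_lamplighter mod_simps add.assoc diff_diff_eq)
next
  fix x assume "x \<in> carrier (lamplighter k)"
  then show "\<one>\<^bsub>lamplighter k\<^esub> \<otimes>\<^bsub>lamplighter k\<^esub> x = x"
    using k by (auto simp: one_lamplighter mult_lamplighter carrier_lamplighter)
next
  fix x assume "x \<in> carrier (lamplighter k)"
  then obtain f m where x: "x = (f, m)" and fin: "finite {i. f i \<noteq> 0}"
    by (auto simp: carrier_lamplighter[OF k])
  let ?y = "(\<lambda>i. (- f (i + m)) mod int k, - m)"
  have "finite {i. (- f (i + m)) mod int k \<noteq> 0}"
    by (rule finite_subset[OF _ finite_support_shift[OF fin, of "- m"]]) auto
  then have "?y \<in> carrier (lamplighter k)"
    using k by (auto simp: carrier_lamplighter)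
  moreover have "?y \<otimes>\<^bsub>lamplighter k\<^esub> x = \<one>\<^bsub>lamplighter k\<^esub>"
    by (simp add: x mult_lamplighter one_lamplighter mod_simps)
  ultimately show "\<exists>y\<in>carrier (lamplighter k). y \<otimes>\<^bsub>lamplighter k\<^esub> x = \<one>\<^bsub>lamplighter k\<^esub>"
    by blast
qed

lemma pow_gen_c:
  assumes k: "k \<ge> 2"
  shows "gen_c [^]\<^bsub>lamplighter k\<^esub> (r::nat) = (\<lambda>i. if i = 0 then int r mod int k else 0, 0)"
proof (induction r)
  case 0
  then show ?case by (simp add: one_lamplighter fun_eq_iff)
next
  case (Suc r)
  then show ?case by (auto simp: gen_c_def mult_lamplighter fun_eq_iff mod_simps add.commute)
qed

lemma cbar_eq:
  assumes k: "k \<ge> 2"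
  shows "cbar k r = (\<lambda>i. if i = 0 then int r mod int k else 0, 1)"
  by (auto simp: cbar_def pow_gen_c[OF k] gen_b_def mult_lamplighter fun_eq_iff)

lemma inj_on_cbar:
  assumes k: "k \<ge> 2"
  shows "inj_on (cbar k) {..<k}"
  by (auto simp: inj_on_def cbar_eq[OF k] fun_eq_iff dest!: spec[of _ 0])

lemma cbar_in_carrier:
  assumes k: "k \<ge> 2"
  shows "cbar k r \<in> carrier (lamplighter k)"
  using k by (auto simp: carrier_lamplighter cbar_eq)

lemma generate_lamplighter_gens:
  assumes k: "k \<ge> 2"
  shows "generate (lamplighter k) (lamplighter_gens k) = carrier (lamplighter k)"
proof -
  interpret L: group "lamplighter k" by (rule group_lamplighter[OF k])
  let ?H = "generate (lamplighter k) (lamplighter_gens k)"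
  have sub: "lamplighter_gens k \<subseteq> carrier (lamplighter k)"
    using cbar_in_carrier[OF k] by (auto simp: lamplighter_gens_def)
  interpret H: subgroup ?H "lamplighter k" by (rule L.generate_is_subgroup[OF sub])
  have cbar: "cbar k r \<in> ?H" if "r < k" for r
    using that by (auto simp: lamplighter_gens_def intro: generate.incl)
  have b: "(\<lambda>_. 0, 1) \<in> ?H"
    using cbar[of 0] k by (simp add: cbar_eq if_distrib cong: if_cong)
  have inv_shift: "inv\<^bsub>lamplighter k\<^esub> (\<lambda>_. 0, n) = (\<lambda>_. 0, - n)" for n
    using k by (intro L.inv_equality)
      (auto simp: mult_lamplighter one_lamplighter carrier_lamplighter)
  have shift_nat: "(\<lambda>_. 0, int n) \<in> ?H" for n
  proof (induction n)
    case 0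
    then show ?case using H.one_closed by (simp add: one_lamplighter)
  next
    case (Suc n)
    from H.m_closed[OF this b] show ?case by (simp add: mult_lamplighter add.commute)
  qed
  have shift: "(\<lambda>_. 0, n) \<in> ?H" for n
  proof (cases "n \<ge> 0")
    case True
    then show ?thesis using shift_nat[of "nat n"] by simp
  next
    case False
    then show ?thesis using H.m_inv_closed[OF shift_nat[of "nat (- n)"]] by (simp add: inv_shift)
  qed
  have lamp0: "(\<lambda>i. if i = 0 then a else 0, 0) \<in> ?H" if "a \<in> {0..<int k}" for a
  proof -
    have "cbar k (nat a) \<otimes>\<^bsub>lamplighter k\<^esub> (\<lambda>_. 0, - 1) \<in> ?H"
      using that by (intro H.m_closed cbar shift) auto
    moreover have "cbar k (nat a) \<otimes>\<^bsub>lamplighter k\<^esub> (\<lambda>_. 0, - 1) = (\<lambda>i. if i = 0 then a else 0, 0)"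
      using that by (auto simp: cbar_eq[OF k] mult_lamplighter fun_eq_iff)
    ultimately show ?thesis by simp
  qed
  have lamp: "(\<lambda>i. if i = j then a else 0, 0) \<in> ?H" if a: "a \<in> {0..<int k}" for a j
  proof -
    have "(\<lambda>_. 0, j) \<otimes>\<^bsub>lamplighter k\<^esub> (\<lambda>i. if i = 0 then a else 0, 0)
        \<otimes>\<^bsub>lamplighter k\<^esub> (\<lambda>_. 0, - j) \<in> ?H"
      by (intro H.m_closed lamp0 shift a)
    moreover have "(\<lambda>_. 0, j) \<otimes>\<^bsub>lamplighter k\<^esub> (\<lambda>i. if i = 0 then a else 0, 0)
        \<otimes>\<^bsub>lamplighter k\<^esub> (\<lambda>_. 0, - j) = (\<lambda>i. if i = j then a else 0, 0)"
      using a by (auto simp: mult_lamplighter fun_eq_iff)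
    ultimately show ?thesis by simp
  qed
  have lamps: "(f, 0) \<in> ?H"
    if "finite A" "{i. f i \<noteq> 0} \<subseteq> A" "\<forall>i. f i \<in> {0..<int k}" for A f
    using that
  proof (induction A arbitrary: f rule: finite_induct)
    case empty
    then have "f = (\<lambda>_. 0)" by auto
    then show ?case using shift[of 0] by simp
  next
    case (insert j A)
    have "(f(j := 0), 0) \<in> ?H"
      using insert.prems k by (intro insert.IH) auto
    moreover have "(\<lambda>i. if i = j then f j else 0, 0) \<in> ?H"
      using insert.prems by (intro lamp) auto
    ultimately have "(f(j := 0), 0) \<otimes>\<^bsub>lamplighter k\<^esub> (\<lambda>i. if i = j then f j else 0, 0) \<in> ?H"
      by (rule H.m_closed)
    moreover have "(f(j := 0), 0) \<otimes>\<^bsub>lamplighter k\<^esub> (\<lambda>i. if i = j then f j else 0, 0) = (f, 0)"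
      using insert.prems by (auto simp: mult_lamplighter fun_eq_iff)
    ultimately show ?case by simp
  qed
  have "x \<in> ?H" if x: "x \<in> carrier (lamplighter k)" for x
  proof -
    obtain f n where fn: "x = (f, n)" "\<forall>i. f i \<in> {0..<int k}" "finite {i. f i \<noteq> 0}"
      using x by (auto simp: carrier_lamplighter[OF k])
    have "(f, 0) \<otimes>\<^bsub>lamplighter k\<^esub> (\<lambda>_. 0, n) \<in> ?H"
      using fn by (intro H.m_closed lamps[of "{i. f i \<noteq> 0}"] shift) auto
    moreover have "(f, 0) \<otimes>\<^bsub>lamplighter k\<^esub> (\<lambda>_. 0, n) = x"
      using fn by (auto simp: mult_lamplighter fun_eq_iff)
    ultimately show ?thesis by simp
  qed
  then show ?thesis using H.subset by blast
qed


section \<open>Existence and uniqueness of the action\<close>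

text \<open>
  Reading words as truncated power series over the integers modulo \<open>k\<close>, the pair \<open>(f, n)\<close> acts by
  \<open>F \<mapsto> (1 + X)\<^sup>n F + (\<Sum>i. f i (1 + X)\<^sup>i)\<close>.
\<close>

definition upow :: "int \<Rightarrow> int fps" where
  "upow n = (if n \<ge> 0 then (1 + fps_X) ^ nat n else Abs_fps (\<lambda>j. (- 1) ^ j) ^ nat (- n))"

lemma upow_unit: "(1 + fps_X) * Abs_fps (\<lambda>j. (- 1) ^ j) = (1 :: int fps)"
proof (rule fps_ext)
  fix n
  show "fps_nth ((1 + fps_X) * Abs_fps (\<lambda>j. (- 1) ^ j)) n = fps_nth (1 :: int fps) n"
    by (cases n) (simp_all add: distrib_right)
qed

lemma upow_0 [simp]: "upow 0 = 1" and upow_1 [simp]: "upow 1 = 1 + fps_X"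
  by (simp_all add: upow_def)

lemma upow_Suc: "upow (n + 1) = (1 + fps_X) * upow n"
proof (cases "n \<ge> 0")
  case True
  then show ?thesis by (simp add: upow_def nat_add_distrib)
next
  case False
  define m where "m = nat (- n) - 1"
  have n: "n = - int m - 1" using False by (simp add: m_def)
  show ?thesis
  proof (cases m)
    case 0
    then show ?thesis using upow_unit by (simp add: upow_def n)
  next
    case (Suc j)
    have "nat (- (n + 1)) = Suc j" "nat (- n) = Suc (Suc j)" "\<not> n + 1 \<ge> 0"
      using n Suc by simp_all
    then show ?thesis using False upow_unit
      by (simp add: upow_def)
  qed
qed

lemma upow_add: "upow (m + n) = upow m * upow n"
proof (induction m rule: int_induct[where k = 0])
  case base
  then show ?case by simp
next
  case (step1 i)
  then show ?case using upow_Suc[of "i + n"] upow_Suc[of i] by (simp add: algebra_simps)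
next
  case (step2 i)
  have "(1 + fps_X) * upow (i - 1 + n) = (1 + fps_X) * (upow (i - 1) * upow n)"
    using step2 upow_Suc[of "i - 1 + n"] upow_Suc[of "i - 1"] by (simp add: algebra_simps)
  moreover have "(1 + fps_X :: int fps) \<noteq> 0"
    using upow_unit by (metis mult_zero_left zero_neq_one)
  ultimately show ?case by simp
qed

definition lamp_series :: "(int \<Rightarrow> int) \<Rightarrow> int fps" where
  "lamp_series f = (\<Sum>i | f i \<noteq> 0. fps_const (f i) * upow i)"

definition word_series :: "int list \<Rightarrow> int fps" where
  "word_series w = Abs_fps (\<lambda>j. if j < length w then w ! j else 0)"

definition series_word :: "nat \<Rightarrow> nat \<Rightarrow> int fps \<Rightarrow> int list" where
  "series_word k N F = map (\<lambda>j. fps_nth F j mod int k) [0..<N]"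

definition tree_act :: "nat \<Rightarrow> (int \<Rightarrow> int) \<times> int \<Rightarrow> int list \<Rightarrow> int list" where
  "tree_act k = (\<lambda>(f, n) w.
     series_word k (length w) (upow n * word_series w + lamp_series f))"

definition fps_cong :: "nat \<Rightarrow> nat \<Rightarrow> int fps \<Rightarrow> int fps \<Rightarrow> bool" where
  "fps_cong k N F G \<longleftrightarrow> (\<forall>j<N. [fps_nth F j = fps_nth G j] (mod int k))"

lemma fps_cong_add: "fps_cong k N F G \<Longrightarrow> fps_cong k N F' G' \<Longrightarrow> fps_cong k N (F + F') (G + G')"
  by (auto simp: fps_cong_def intro: cong_add)

lemma fps_cong_mult: "fps_cong k N F G \<Longrightarrow> fps_cong k N (H * F) (H * G)"
  by (auto simp: fps_cong_def fps_mult_nth intro!: cong_sum cong_mult)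

lemma series_word_cong: "fps_cong k N F G \<Longrightarrow> series_word k N F = series_word k N G"
  by (auto simp: fps_cong_def series_word_def cong_def)

lemma word_series_word: "fps_cong k N (word_series (series_word k N F)) F"
  by (auto simp: fps_cong_def series_word_def word_series_def cong_def)

lemma series_word_series:
  assumes "w \<in> words k"
  shows "series_word k (length w) (word_series w) = w"
proof (rule nth_equalityI)
  fix i assume "i < length (series_word k (length w) (word_series w))"
  then have i: "i < length w" by (simp add: series_word_def)
  then have "w ! i \<in> {0..<int k}" using assms nth_mem[of i w] by (auto simp: words_def)
  then show "series_word k (length w) (word_series w) ! i = w ! i"
    using i by (simp add: series_word_def word_series_def)
qed (simp add: series_word_def)

lemma lamp_series_superset:
  assumes "finite A" "{i. f i \<noteq> 0} \<subseteq> A"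
  shows "lamp_series f = (\<Sum>i\<in>A. fps_const (f i) * upow i)"
  unfolding lamp_series_def using assms by (intro sum.mono_neutral_left) auto

lemma lamp_series_shift: "lamp_series (\<lambda>i. g (i - m)) = upow m * lamp_series g"
proof -
  have "lamp_series (\<lambda>i. g (i - m)) = (\<Sum>i | g i \<noteq> 0. fps_const (g i) * upow (m + i))"
    unfolding lamp_series_def
    by (rule sum.reindex_bij_witness[of _ "\<lambda>i. i + m" "\<lambda>i. i - m"]) auto
  then show ?thesis by (simp add: lamp_series_def upow_add sum_distrib_left mult_ac)
qed

lemma lamp_series_add:
  assumes "finite {i. f i \<noteq> 0}" "finite {i. g i \<noteq> 0}"
  shows "fps_cong k N (lamp_series (\<lambda>i. (f i + g i) mod int k)) (lamp_series f + lamp_series g)"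
proof -
  let ?A = "{i. f i \<noteq> 0} \<union> {i. g i \<noteq> 0}"
  have fin: "finite ?A" using assms by simp
  have "lamp_series (\<lambda>i. (f i + g i) mod int k) =
      (\<Sum>i\<in>?A. fps_const ((f i + g i) mod int k) * upow i)"
    by (rule lamp_series_superset[OF fin]) auto
  moreover have "lamp_series f + lamp_series g = (\<Sum>i\<in>?A. fps_const (f i + g i) * upow i)"
    using lamp_series_superset[OF fin, of f] lamp_series_superset[OF fin, of g]
    by (simp add: sum.distrib distrib_right flip: fps_const_add)
  ultimately show ?thesis
    by (auto simp: fps_cong_def fps_sum_nth intro!: cong_sum cong_mult)
qed

lemma tree_act_in_words:
  assumes "k \<ge> 2"
  shows "tree_act k x w \<in> words k"
  using assms by (auto simp: tree_act_def series_word_def words_def split: prod.splits)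

lemma length_tree_act [simp]: "length (tree_act k x w) = length w"
  by (auto simp: tree_act_def series_word_def split: prod.splits)

lemma tree_act_one: "w \<in> words k \<Longrightarrow> tree_act k \<one>\<^bsub>lamplighter k\<^esub> w = w"
  by (simp add: tree_act_def one_lamplighter lamp_series_def series_word_series)

lemma tree_act_mult:
  assumes k: "k \<ge> 2"
    and x: "x \<in> carrier (lamplighter k)" and y: "y \<in> carrier (lamplighter k)"
  shows "tree_act k (x \<otimes>\<^bsub>lamplighter k\<^esub> y) w = tree_act k x (tree_act k y w)"
proof -
  obtain f m g n where xy: "x = (f, m)" "y = (g, n)"
    and fin: "finite {i. f i \<noteq> 0}" "finite {i. g i \<noteq> 0}"
    using x y by (auto simp: carrier_lamplighter[OF k])
  let ?N = "length w" and ?W = "word_series w"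
  have "fps_cong k ?N (upow m * word_series (tree_act k y w) + lamp_series f)
      (upow m * (upow n * ?W + lamp_series g) + lamp_series f)"
    unfolding xy tree_act_def prod.case
    by (intro fps_cong_add fps_cong_mult word_series_word) (simp add: fps_cong_def)
  then have "tree_act k x (tree_act k y w) =
      series_word k ?N (upow m * (upow n * ?W + lamp_series g) + lamp_series f)"
    using length_tree_act[of k y w]
    by (simp add: tree_act_def[of k] xy) (rule series_word_cong)
  moreover have "fps_cong k ?N
      (upow (m + n) * ?W + lamp_series (\<lambda>i. (f i + g (i - m)) mod int k))
      (upow (m + n) * ?W + (lamp_series f + lamp_series (\<lambda>i. g (i - m))))"
    by (intro fps_cong_add lamp_series_add fin finite_support_shift) (simp add: fps_cong_def)
  then have "tree_act k (x \<otimes>\<^bsub>lamplighter k\<^esub> y) w =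
      series_word k ?N (upow (m + n) * ?W + (lamp_series f + lamp_series (\<lambda>i. g (i - m))))"
    by (simp add: xy mult_lamplighter tree_act_def series_word_cong)
  ultimately show ?thesis
    by (simp add: lamp_series_shift upow_add algebra_simps)
qed

lemma tree_act_cbar:
  assumes k: "k \<ge> 2" and r: "r < k"
  shows "tree_act k (cbar k r) w = cbar_word k r w"
proof -
  have "lamp_series (\<lambda>i. if i = 0 then int r else 0) = fps_const (int r)"
    by (subst lamp_series_superset[of "{0}"]) auto
  then have "tree_act k (cbar k r) w =
      series_word k (length w) ((1 + fps_X) * word_series w + fps_const (int r))"
    using r by (simp add: tree_act_def cbar_eq[OF k] cong: if_cong)
  also have "\<dots> = cbar_word k r w"
  proof (rule nth_equalityI)
    fix i assume "i < length (series_word k (length w)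
      ((1 + fps_X) * word_series w + fps_const (int r)))"
    then have i: "i < length w" by (simp add: series_word_def)
    then show "series_word k (length w) ((1 + fps_X) * word_series w + fps_const (int r)) ! i
        = cbar_word k r w ! i"
      by (cases i)
        (simp_all add: series_word_def word_series_def cbar_word_def distrib_right)
  qed (simp add: series_word_def cbar_word_def)
  finally show ?thesis .
qed

lemma ex1_lamplighter_action:
  assumes k: "k \<ge> 2"
  shows "\<exists>!\<phi>. is_lamplighter_action k \<phi>"
proof (rule ex_ex1I)
  interpret L: group "lamplighter k" by (rule group_lamplighter[OF k])
  let ?\<phi> = "\<lambda>x\<in>carrier (lamplighter k). \<lambda>w\<in>words k. tree_act k x w"
  have bij: "(\<lambda>w\<in>words k. tree_act k x w) \<in> Bij (words k)"
    if x: "x \<in> carrier (lamplighter k)" for x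
  proof -
    have inv: "inv\<^bsub>lamplighter k\<^esub> x \<in> carrier (lamplighter k)"
      using x by simp
    have "tree_act k (inv\<^bsub>lamplighter k\<^esub> x) (tree_act k x w) = w" if "w \<in> words k" for w
      using that by (simp only: tree_act_mult[OF k inv x, symmetric] L.l_inv[OF x] tree_act_one)
    moreover have "tree_act k x (tree_act k (inv\<^bsub>lamplighter k\<^esub> x) w) = w" if "w \<in> words k" for w
      using that by (simp only: tree_act_mult[OF k x inv, symmetric] L.r_inv[OF x] tree_act_one)
    ultimately have "bij_betw (tree_act k x) (words k) (words k)"
      by (intro bij_betw_byWitness[where f' = "tree_act k (inv\<^bsub>lamplighter k\<^esub> x)"])
        (blast intro: tree_act_in_words[OF k])+
    then show ?thesis by (simp add: Bij_def)
  qed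
  have "?\<phi> \<in> hom (lamplighter k) (BijGroup (words k))"
  proof (rule homI)
    fix x y assume xy: "x \<in> carrier (lamplighter k)" "y \<in> carrier (lamplighter k)"
    then show "?\<phi> (x \<otimes>\<^bsub>lamplighter k\<^esub> y) = ?\<phi> x \<otimes>\<^bsub>BijGroup (words k)\<^esub> ?\<phi> y"
      using bij tree_act_in_words[OF k]
      by (auto simp: BijGroup_def compose_def tree_act_mult[OF k] fun_eq_iff)
  qed (use bij in \<open>simp add: BijGroup_def\<close>)
  then have "group_action (lamplighter k) (words k) ?\<phi>"
    by (intro group_action.intro group_hom.intro group_hom_axioms.intro group_BijGroup)
      (rule L.group_axioms)
  then have "is_lamplighter_action k ?\<phi>"
    using cbar_in_carrier[OF k] tree_act_cbar[OF k] by (auto simp: is_lamplighter_action_def)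
  then show "\<exists>\<phi>. is_lamplighter_action k \<phi>" by blast
next
  interpret L: group "lamplighter k" by (rule group_lamplighter[OF k])
  fix \<phi> \<psi> assume \<phi>: "is_lamplighter_action k \<phi>" and \<psi>: "is_lamplighter_action k \<psi>"
  interpret \<phi>: group_hom "lamplighter k" "BijGroup (words k)" \<phi>
    using \<phi> by (simp add: is_lamplighter_action_def group_action_def)
  interpret \<psi>: group_hom "lamplighter k" "BijGroup (words k)" \<psi>
    using \<psi> by (simp add: is_lamplighter_action_def group_action_def)
  have gens: "\<phi> x = \<psi> x" if x: "x \<in> lamplighter_gens k" for x
  proof (rule extensionalityI[of _ "words k"])
    have "x \<in> carrier (lamplighter k)"
      using x cbar_in_carrier[OF k] by (auto simp: lamplighter_gens_def)
    then show "\<phi> x \<in> extensional (words k)" "\<psi> x \<in> extensional (words k)"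
      using \<phi>.hom_closed[of x] \<psi>.hom_closed[of x] by (simp_all add: BijGroup_def Bij_def)
    show "\<phi> x w = \<psi> x w" if "w \<in> words k" for w
      using x that \<phi> \<psi> by (auto simp: is_lamplighter_action_def lamplighter_gens_def)
  qed
  have sub: "lamplighter_gens k \<subseteq> carrier (lamplighter k)"
    using cbar_in_carrier[OF k] by (auto simp: lamplighter_gens_def)
  have gen: "\<phi> x = \<psi> x" if "x \<in> generate (lamplighter k) (lamplighter_gens k)" for x
    using that
  proof (induction rule: generate.induct)
    case one
    then show ?case by simp
  next
    case (incl h)
    then show ?case by (rule gens)
  next
    case (inv h)
    then show ?case using gens[OF inv] sub by auto
  next
    case (eng h1 h2)
    then show ?case using L.generate_in_carrier[OF sub] by simp
  qed
  show "\<phi> = \<psi>"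
  proof (rule extensionalityI[of _ "carrier (lamplighter k)"])
    show "\<phi> \<in> extensional (carrier (lamplighter k))" "\<psi> \<in> extensional (carrier (lamplighter k))"
      using \<phi> \<psi> by (simp_all add: is_lamplighter_action_def)
    show "\<phi> x = \<psi> x" if "x \<in> carrier (lamplighter k)" for x
      using that gen by (simp add: generate_lamplighter_gens[OF k])
  qed
qed

lemma is_lamplighter_action_lamplighter_action:
  assumes "k \<ge> 2"
  shows "is_lamplighter_action k (lamplighter_action k)"
  unfolding lamplighter_action_def by (rule theI'[OF ex1_lamplighter_action[OF assms]])

end

(*
  Edges of both graphs at level N are words of length N + 1: the pair (w, y) is the word w y, and the
  edge from v labelled by c^r b is the word r v.  Deleting the last letter of w y gives the tail and
  deleting the first one gives the head, while r v has tail v and its head c^r b . v consists of the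
  letters of c^0 b . (r v) after the first.  Record for a word w of length n the last letters of w,
  T w, ..., T^(n-1) w, where T is the action of c^0 b.  As the last letter of T^j w depends only on
  the last j + 1 letters of w, the code of v is the code of r v without its last letter, and the code
  of c^r b . v is the code of r v without its first letter.  So the coding, which is injective, is an
  isomorphism of graphs.
*)
theory Submission
  imports Defs
begin

lemma length_cbar_word [simp]: "length (cbar_word k r w) = length w"
  by (simp add: cbar_word_def)

text \<open>Self-similarity of the action: the first letter acts on the rest of the word as the
  parameter. \<open>x \<ge> 0\<close> gives \<open>int (nat x) = x\<close>.\<close>

lemma cbar_word_Cons:
  "x \<ge> 0 \<Longrightarrow> cbar_word k r (x # w) = ((x + int r) mod int k) # cbar_word k (nat x) w"
  by (simp add: cbar_word_def)

lemma cbar_word_in_level: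
  assumes "k > 0" "w \<in> level k N"
  shows "cbar_word k r w \<in> level k N"
  using assms by (auto simp: level_def words_def cbar_word_def)

lemma level_0: "level k 0 = {[]}"
  by (auto simp: level_def words_def)

lemma Cons_in_level_iff:
  "x # w \<in> level k (Suc N) \<longleftrightarrow> x \<in> {0..<int k} \<and> w \<in> level k N"
  by (auto simp: level_def words_def)

lemma snoc_in_level_iff:
  "w @ [x] \<in> level k (Suc N) \<longleftrightarrow> w \<in> level k N \<and> x \<in> {0..<int k}"
  by (auto simp: level_def words_def)

lemma level_Suc_cases:
  assumes "w \<in> level k (Suc N)"
  obtains x v where "w = x # v" "x \<in> {0..<int k}" "v \<in> level k N"
  using assms by (cases w) (auto simp: level_def words_def)

lemma finite_level: "finite (level k N)"
proof -
  have "level k N = {w. set w \<subseteq> {0..<int k} \<and> length w = N}"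
    by (auto simp: level_def words_def)
  then show ?thesis by (simp add: finite_lists_length_eq)
qed

text \<open>
  The list of the last letters of \<open>w\<close>, \<open>T w\<close>, \<open>T\<^sup>2 w\<close>, \<dots>: the recursion drops the first
  letter of \<open>T (x # w)\<close>, since the last letters to be recorded no longer depend on it.
\<close>

function orbit_code :: "nat \<Rightarrow> int list \<Rightarrow> int list" where
  "orbit_code k [] = []"
| "orbit_code k (x # w) = last (x # w) # orbit_code k (cbar_word k (nat x) w)"
  by pat_completeness auto
termination by (relation "measure (\<lambda>(k, w). length w)") auto

lemma length_orbit_code [simp]: "length (orbit_code k w) = length w"
  by (induction k w rule: orbit_code.induct) auto

lemma orbit_code_in_level:
  assumes "k > 0" "w \<in> level k N"
  shows "orbit_code k w \<in> level k N"
  using assms(2)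
proof (induction N arbitrary: w)
  case 0
  then show ?case by (simp add: level_0)
next
  case (Suc N)
  then obtain x v where w: "w = x # v" and v: "v \<in> level k N"
    by (auto elim: level_Suc_cases)
  have "last w \<in> {0..<int k}"
    using Suc.prems last_in_set[of w] by (auto simp: w level_def words_def)
  then show ?case
    using Suc.IH[OF cbar_word_in_level[OF assms(1) v]] by (simp add: w Cons_in_level_iff)
qed

text \<open>Each application of \<open>T\<close> carries the influence of \<open>x\<close> one place
  further to the right, so it reaches only the last entry of the code.\<close>

lemma butlast_orbit_code_Cons:
  assumes "k > 0" "x \<ge> 0" "w \<in> level k N"
  shows "butlast (orbit_code k (x # w)) = orbit_code k w"
  using assms(2,3)
proof (induction N arbitrary: x w)
  case 0
  then show ?case by (simp add: level_0 cbar_word_def)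
next
  case (Suc N)
  then obtain y v where w: "w = y # v" "y \<ge> 0" and v: "v \<in> level k N"
    by (auto elim: level_Suc_cases)
  \<comment> \<open>\<open>?z # ?v\<close> is \<open>cbar_word k (nat x) w\<close>, and
    \<open>orbit_code k ?v\<close> is the code of \<open>w\<close> after its first entry
    \<open>last w\<close>, which both sides share.\<close>
  let ?z = "(y + x) mod int k" and ?v = "cbar_word k (nat y) v"
  have "butlast (orbit_code k (?z # ?v)) = orbit_code k ?v"
    using assms(1) by (intro Suc.IH cbar_word_in_level v) auto
  moreover have "orbit_code k (?z # ?v) \<noteq> []" by simp
  ultimately show ?case
    using w Suc.prems(1) by (simp add: cbar_word_Cons orbit_code.simps(2)[of k x] orbit_code.simps(2)[of k y]
      del: orbit_code.simps(2))
qed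

lemma orbit_code_snoc:
  assumes "k > 0" "x \<ge> 0" "w \<in> level k N"
  shows "orbit_code k w @ [last (orbit_code k (x # w))] = orbit_code k (x # w)"
  using butlast_orbit_code_Cons[OF assms] append_butlast_last_id[of "orbit_code k (x # w)"]
  by simp

text \<open>Dropping the last entry of the code of \<open>x # v\<close> leaves the code of
  \<open>v\<close>, hence determines \<open>v\<close>; dropping the first entry then determines
  \<open>cbar_word k (nat x) v\<close>.\<close>

lemma inj_on_orbit_code:
  assumes "k > 0"
  shows "inj_on (orbit_code k) (level k N)"
proof (induction N)
  case 0
  then show ?case by (simp add: level_0)
next
  case (Suc N)
  show ?case
  proof (rule inj_onI)
    fix w w' assume ww': "w \<in> level k (Suc N)" "w' \<in> level k (Suc N)"
      and eq: "orbit_code k w = orbit_code k w'"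
    obtain x v where w: "w = x # v" "x \<in> {0..<int k}" "v \<in> level k N"
      using ww'(1) by (rule level_Suc_cases)
    obtain x' v' where w': "w' = x' # v'" "x' \<in> {0..<int k}" "v' \<in> level k N"
      using ww'(2) by (rule level_Suc_cases)
    have "orbit_code k v = orbit_code k v'"
      using eq w w' butlast_orbit_code_Cons[OF assms] by (metis atLeastLessThan_iff)
    then have v: "v = v'"
      using Suc.IH w(3) w'(3) by (simp add: inj_on_def)
    have "orbit_code k (cbar_word k (nat x) v) = orbit_code k (cbar_word k (nat x') v)"
      using eq by (simp add: w w' v)
    then have c: "cbar_word k (nat x) v = cbar_word k (nat x') v"
      using Suc.IH cbar_word_in_level[OF assms w(3)] by (simp add: inj_on_def)
    \<comment> \<open>The first letter of \<open>cbar_word k (nat x) v\<close> reveals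
      \<open>x\<close> modulo \<open>k\<close>. It is missing for empty \<open>v\<close>, but then
      the code is \<open>[x]\<close>.\<close>
    have "x = x'"
    proof (cases v)
      case Nil
      then show ?thesis using eq by (simp add: w w' v)
    next
      case (Cons y u)
      then have "y \<ge> 0" using w(3) by (auto simp: level_def words_def)
      then have "[y + x = y + x'] (mod int k)"
        using c w(2) w'(2) by (simp add: Cons cbar_word_Cons cong_def)
      then have "[x = x'] (mod int k)"
        by (simp add: cong_add_lcancel)
      then show ?thesis using w(2) w'(2) by (simp add: cong_def)
    qed
    then show "w = w'" by (simp add: w w' v)
  qed
qed

text \<open>Finiteness turns injectivity into surjectivity, so no decoding is constructed.\<close>

lemma orbit_code_image_level:
  assumes "k > 0"
  shows "orbit_code k ` level k N = level k N"
  using assms by (intro endo_inj_surj finite_level inj_on_orbit_code)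
    (auto intro: orbit_code_in_level)

lemma lamplighter_action_cbar:
  assumes "k \<ge> 2" "r < k" "w \<in> level k N"
  shows "lamplighter_action k (cbar k r) w = cbar_word k r w"
  using is_lamplighter_action_lamplighter_action[OF assms(1)] assms(2,3)
  by (auto simp: is_lamplighter_action_def level_def)

lemma arcs_lamplighter_graphE:
  assumes "k \<ge> 2" "a \<in> arcs (lamplighter_graph k N)"
  obtains v r where "a = (v, cbar k r)" "v \<in> level k N" "r < k" "fst (cbar k r) 0 = int r"
  using assms by (auto simp: lamplighter_graph_def action_graph_def lamplighter_gens_def cbar_eq)

lemma wf_digraph_lamplighter_graph:
  assumes "k \<ge> 2"
  shows "wf_digraph (lamplighter_graph k N)"
  by unfold_locales
    (use assms cbar_word_in_level in \<open>auto simp: lamplighter_graph_def action_graph_def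
      lamplighter_gens_def lamplighter_action_cbar\<close>)

lemma digraph_iso_lamplighter_graph_de_bruijn:
  assumes k: "k \<ge> 2"
  shows "digraph_iso (lamplighter_graph k N) (de_bruijn k N)"
proof -
  let ?G = "lamplighter_graph k N"
  have k0: "k > 0" using k by simp
  \<comment> \<open>\<open>fst g 0\<close> recovers \<open>r\<close> from \<open>g = cbar k r\<close>.\<close>
  define arc where "arc = (\<lambda>(v, g :: (int \<Rightarrow> int) \<times> int).
    (orbit_code k v, last (orbit_code k (fst g 0 # v))))"
  \<comment> \<open>The last two fields become the head and tail functions of
    \<open>app_iso ?f ?G\<close>, which makes it equal to the de Bruijn graph as a record.\<close>
  let ?f = "\<lparr>iso_verts = orbit_code k, iso_arcs = arc,
    iso_head = head (de_bruijn k N), iso_tail = tail (de_bruijn k N)\<rparr>"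
  \<comment> \<open>With edges read as words of length \<open>N + 1\<close>, \<open>arc\<close> is
    the coding itself, so its bijectivity comes from level \<open>N + 1\<close>.\<close>
  have snoc: "fst (arc (v, g)) @ [snd (arc (v, g))] = orbit_code k (fst g 0 # v)"
    if "v \<in> level k N" "fst g 0 \<ge> 0" for v g
    using orbit_code_snoc[OF k0 that(2,1)] by (simp add: arc_def)
  have "inj_on arc (arcs ?G)"
  proof (rule inj_onI)
    fix a b assume ab: "a \<in> arcs ?G" "b \<in> arcs ?G" and eq: "arc a = arc b"
    obtain v r where a: "a = (v, cbar k r)" "v \<in> level k N" "r < k" "fst (cbar k r) 0 = int r"
      by (rule arcs_lamplighter_graphE[OF k ab(1)])
    obtain w s where b: "b = (w, cbar k s)" "w \<in> level k N" "s < k" "fst (cbar k s) 0 = int s"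
      by (rule arcs_lamplighter_graphE[OF k ab(2)])
    have "orbit_code k (int r # v) = orbit_code k (int s # w)"
      using snoc[of v "cbar k r"] snoc[of w "cbar k s"] a b eq by simp
    then have "int r # v = int s # w"
      by (rule inj_onD[OF inj_on_orbit_code[OF k0, of "Suc N"]])
        (use a b in \<open>simp_all add: Cons_in_level_iff\<close>)
    then show "a = b" by (simp add: a b)
  qed
  moreover have "orbit_code k (tail ?G a) = tail (de_bruijn k N) (arc a) \<and>
      orbit_code k (head ?G a) = head (de_bruijn k N) (arc a)" if aG: "a \<in> arcs ?G" for a
  proof -
    obtain v r where a: "a = (v, cbar k r)" "v \<in> level k N" "r < k" "fst (cbar k r) 0 = int r"
      by (rule arcs_lamplighter_graphE[OF k aG])
    \<comment> \<open>By the recursion, this tail is the code of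
      \<open>cbar_word k r v\<close>.\<close>
    have "head (de_bruijn k N) (arc a) = tl (orbit_code k (int r # v))"
      using snoc[of v "cbar k r"] a by (simp add: de_bruijn_def split_beta)
    then show ?thesis
      using a k by (simp add: lamplighter_graph_def action_graph_def de_bruijn_def arc_def
        lamplighter_action_cbar)
  qed
  ultimately have "pre_digraph.digraph_isomorphism ?G ?f"
    using wf_digraph_lamplighter_graph[OF k] inj_on_orbit_code[OF k0]
    by (simp add: pre_digraph.digraph_isomorphism_def)
      (simp add: lamplighter_graph_def action_graph_def)
  moreover have "arc ` arcs ?G = arcs (de_bruijn k N)"
  proof (intro equalityI subsetI)
    fix e assume "e \<in> arc ` arcs ?G"
    then obtain a where e: "e = arc a" and "a \<in> arcs ?G" by blast
    then obtain v r where a: "a = (v, cbar k r)" "v \<in> level k N" "r < k"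
        "fst (cbar k r) 0 = int r"
      by (blast elim: arcs_lamplighter_graphE[OF k])
    have "orbit_code k (int r # v) \<in> level k (Suc N)"
      using a by (intro orbit_code_in_level k0) (simp add: Cons_in_level_iff)
    then have "fst e \<in> level k N \<and> snd e \<in> {0..<int k}"
      using snoc[of v "cbar k r"] a e snoc_in_level_iff[of "fst e" "snd e" k N]
      by (simp del: orbit_code.simps)
    then show "e \<in> arcs (de_bruijn k N)"
      by (simp add: de_bruijn_def mem_Times_iff)
  next
    fix e assume "e \<in> arcs (de_bruijn k N)"
    \<comment> \<open>In a word coded by \<open>fst e @ [snd e]\<close>, the first letter gives the
      label of the required edge and the rest its starting vertex.\<close>
    then have "fst e @ [snd e] \<in> orbit_code k ` level k (Suc N)"
      unfolding orbit_code_image_level[OF k0] by (auto simp: de_bruijn_def snoc_in_level_iff)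
    then obtain u where "u \<in> level k (Suc N)" "fst e @ [snd e] = orbit_code k u"
      by blast
    then obtain x v where x: "x \<in> {0..<int k}" and v: "v \<in> level k N"
      and e: "fst e @ [snd e] = orbit_code k (x # v)"
      by (auto elim: level_Suc_cases)
    have g: "fst (cbar k (nat x)) 0 = x"
      using x by (simp add: cbar_eq[OF k])
    let ?a = "(v, cbar k (nat x))"
    have "fst e @ [snd e] = fst (arc ?a) @ [snd (arc ?a)]"
      using snoc[of v "cbar k (nat x)"] v x e g by simp
    then have "e = arc ?a"
      by (simp add: prod_eq_iff)
    moreover have "?a \<in> arcs ?G"
      using v x by (auto simp: lamplighter_graph_def action_graph_def lamplighter_gens_def)
    ultimately show "e \<in> arc ` arcs ?G" by blast
  qed
  then have "de_bruijn k N = app_iso ?f ?G"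
    using orbit_code_image_level[OF k0, of N]
    by (intro pre_digraph.equality)
      (simp_all add: lamplighter_graph_def action_graph_def de_bruijn_def)
  ultimately show ?thesis
    unfolding digraph_iso_def by blast
qed

theorem theorem4p14:
  fixes k :: nat
  assumes "k \<ge> 2"
  shows "\<forall>N::nat. digraph_iso (de_bruijn k N) (lamplighter_graph k N)"
  using digraph_iso_swap[OF wf_digraph_lamplighter_graph
    digraph_iso_lamplighter_graph_de_bruijn] assms by blast

end
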